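(* Let $X$ and $Y$ be triangulable spaces and let $f:X\to\mathbb{R}^n$, $g:Y\to\mathbb{R}^n$ be continuous functions. Let $(u,v),(u',v')\in\Delta^+$. If, for some degree $i$, $\beta_{(X,f,i)}(u,v)>\beta_{(Y,g,i)}(u',v')$, then $$\delta\big((X,f),(Y,g)\big)\ \ge\ \min\Big\{\min_r\{u'_r-u_r\},\ \min_r\{v_r-v'_r\}\Big\},$$ where $r$ ranges over $1,\ldots,n$ and $\delta$ is the natural pseudodistance.
   Context: For $u,v\in\mathbb{R}^n$, $u\prec v$ (resp. $u\preceq v$) means $u_j<v_j$ (resp. $u_j\le v_j$) for all $j=1,\ldots,n$. $\Delta^+=\{(u,v)\in\mathbb{R}^n\times\mathbb{R}^n : u\prec v\}$. $\mathbb{R}^n$ carries the max norm $\|\cdot\|$. Persistent Betti numbers: fix a field $\mathbb{K}$. A space is triangulable if it is homeomorphic to the underlying space of a finite simplicial complex. For a triangulable space $Z$, a continuous $f:Z\to\mathbb{R}^n$ and $i\in\mathbb{Z}$, let $Z\langle f\preceq u\rangle=\{p\in Z: f_j(p)\le u_j,\ j=1,\ldots,n\}$; then $\beta_{(Z,f,i)}:\Delta^+\to\mathbb{N}$ is defined by letting $\beta_{(Z,f,i)}(u,v)$ be the dimension of the image of the homomorphism $\check H_i(Z\langle f\preceq u\rangle)\to\check H_i(Z\langle f\preceq v\rangle)$ induced by inclusion, where $\check H_i$ is the $i$-th Čech homology with coefficients in $\mathbb{K}$. Natural pseudodistance: $\delta((X,f),(Y,g))=\inf_h\max_{x\in X}\|f(x)-g(h(x))\|$,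 where $h$ varies over all homeomorphisms from $X$ to $Y$, if $X$ and $Y$ are homeomorphic; and $+\infty$ otherwise. *)

theory Defs
  imports
    "HOL-Algebra.Module"
    "HOL-Analysis.Analysis"
    "HOL-Library.Poly_Mapping"
    "HOL-Library.Extended_Nat"
begin

section \<open>Dimension of a vector space\<close>

text \<open>
  Vector spaces over the field \<open>'k\<close> are represented by the module records of HOL-Algebra.  Their
  components \<open>mult\<close> and \<open>one\<close> are irrelevant for modules and are left unspecified below.
  The dimension is the largest size of a finite linearly independent set; it is \<open>\<infinity>\<close>
  (and not a default value \<open>0\<close>) for an infinite-dimensional space.
\<close>

definition lin_independent :: "('k::field, 'm) module \<Rightarrow> 'm set \<Rightarrow> bool" where
  "lin_independent M S \<longleftrightarrow>
     finite S \<and> S \<subseteq> carrier M \<and>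
     (\<forall>c. (\<Oplus>\<^bsub>M\<^esub>x\<in>S. c x \<odot>\<^bsub>M\<^esub> x) = \<zero>\<^bsub>M\<^esub> \<longrightarrow> (\<forall>x\<in>S. c x = 0))"

definition vs_dim :: "('k::field, 'm) module \<Rightarrow> enat" where
  "vs_dim M = (SUP S\<in>{S. lin_independent M S}. enat (card S))"


section \<open>Simplicial homology with coefficients in a field\<close>

text \<open>
  An abstract simplicial complex is the set of its simplices, which are finite nonempty sets of
  vertices.  The chains are the ordered ones: a generator in degree \<open>q\<close> is a list of \<open>q + 1\<close>
  vertices, possibly with repetitions, that all lie in one simplex.
\<close>

type_synonym ('v, 'k) chain = "'v list \<Rightarrow>\<^sub>0 'k"

definition chain_smult :: "'k::field \<Rightarrow> ('v, 'k) chain \<Rightarrow> ('v, 'k) chain" where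
  "chain_smult a = Poly_Mapping.map (\<lambda>x. a * x)"

definition chains :: "'v set set \<Rightarrow> int \<Rightarrow> ('v, 'k::field) chain set" where
  "chains K q = {c. \<forall>s\<in>Poly_Mapping.keys c. int (length s) = q + 1 \<and> set s \<in> K}"

text \<open>
  Lists of length \<open>1\<close> have boundary \<open>0\<close>: the chain complex is not augmented.
\<close>

definition boundary :: "('v, 'k::field) chain \<Rightarrow> ('v, 'k) chain" where
  "boundary c =
     (\<Sum>s\<in>Poly_Mapping.keys c.
        if length s \<le> 1 then 0
        else \<Sum>j<length s. Poly_Mapping.single (take j s @ drop (Suc j) s)
                              ((-1) ^ j * Poly_Mapping.lookup c s))"

definition cycles :: "'v set set \<Rightarrow> int \<Rightarrow> ('v, 'k::field) chain set" where
  "cycles K q = {z \<in> chains K q. boundary z = 0}"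

definition boundaries :: "'v set set \<Rightarrow> int \<Rightarrow> ('v, 'k::field) chain set" where
  "boundaries K q = boundary ` chains K (q + 1)"

definition simplicial_homology ::
    "'v set set \<Rightarrow> int \<Rightarrow> ('k::field, ('v, 'k) chain set) module" where
  "simplicial_homology K q =
     \<lparr>carrier = (\<lambda>z. {z + b | b. b \<in> boundaries K q}) ` cycles K q,
      monoid.mult = undefined, monoid.one = undefined,
      ring.zero = boundaries K q,
      ring.add = (\<lambda>A B. {a + b | a b. a \<in> A \<and> b \<in> B}),
      module.smult = (\<lambda>r A. {chain_smult r a + b | a b. a \<in> A \<and> b \<in> boundaries K q})\<rparr>"

definition chain_map :: "('v \<Rightarrow> 'w) \<Rightarrow> ('v, 'k::field) chain \<Rightarrow> ('w, 'k) chain" where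
  "chain_map p c =
     (\<Sum>s\<in>Poly_Mapping.keys c. Poly_Mapping.single (map p s) (Poly_Mapping.lookup c s))"

text \<open>The homomorphism induced by a simplicial map \<open>p\<close> into the complex \<open>L\<close>.\<close>

definition homology_map ::
    "'w set set \<Rightarrow> int \<Rightarrow> ('v \<Rightarrow> 'w) \<Rightarrow> ('v, 'k::field) chain set \<Rightarrow> ('w, 'k) chain set" where
  "homology_map L q p A = {chain_map p a + b | a b. a \<in> A \<and> b \<in> boundaries L q}"


section \<open>Cech homology\<close>

definition open_cover :: "'a topology \<Rightarrow> 'a set set \<Rightarrow> bool" where
  "open_cover X \<U> \<longleftrightarrow> (\<forall>U\<in>\<U>. openin X U) \<and> \<Union>\<U> = topspace X"

definition nerve :: "'a set set \<Rightarrow> 'a set set set" where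
  "nerve \<U> = {\<sigma>. finite \<sigma> \<and> \<sigma> \<noteq> {} \<and> \<sigma> \<subseteq> \<U> \<and> \<Inter>\<sigma> \<noteq> {}}"

text \<open>
  A projection from a cover \<open>\<V>\<close> to a cover \<open>\<U>\<close> along a map \<open>f\<close>; it is only constrained on the
  vertices of the nerve of \<open>\<V>\<close>, which are the nonempty members of \<open>\<V>\<close>.
  For \<open>f = id\<close> its existence means that \<open>\<V>\<close> refines \<open>\<U>\<close>.  Any two projections are contiguous
  and hence induce the same map on the homology of the nerves.
\<close>

definition cover_projection ::
    "('a \<Rightarrow> 'b) \<Rightarrow> 'a set set \<Rightarrow> 'b set set \<Rightarrow> ('a set \<Rightarrow> 'b set) \<Rightarrow> bool" where
  "cover_projection f \<V> \<U> p \<longleftrightarrow> (\<forall>V\<in>\<V>. V \<noteq> {} \<longrightarrow> p V \<in> \<U> \<and> f ` V \<subseteq> p V)"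

text \<open>The inverse limit of the homology of the nerves over all open covers of \<open>X\<close>.\<close>

definition cech_homology ::
    "'a topology \<Rightarrow> int \<Rightarrow> ('k::field, 'a set set \<Rightarrow> ('a set, 'k) chain set) module" where
  "cech_homology X q =
     \<lparr>carrier =
        {h \<in> (\<Pi>\<^sub>E \<U>\<in>{\<U>. open_cover X \<U>}. carrier (simplicial_homology (nerve \<U>) q)).
           \<forall>\<U> \<V> p. open_cover X \<U> \<and> open_cover X \<V> \<and> cover_projection id \<V> \<U> p \<longrightarrow>
             homology_map (nerve \<U>) q p (h \<V>) = h \<U>},
      monoid.mult = undefined, monoid.one = undefined,
      ring.zero = (\<lambda>\<U>\<in>{\<U>. open_cover X \<U>}. \<zero>\<^bsub>simplicial_homology (nerve \<U>) q\<^esub>),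
      ring.add = (\<lambda>h h'. \<lambda>\<U>\<in>{\<U>. open_cover X \<U>}. h \<U> \<oplus>\<^bsub>simplicial_homology (nerve \<U>) q\<^esub> h' \<U>),
      module.smult = (\<lambda>r h. \<lambda>\<U>\<in>{\<U>. open_cover X \<U>}. r \<odot>\<^bsub>simplicial_homology (nerve \<U>) q\<^esub> h \<U>)\<rparr>"

definition pullback_cover :: "'a topology \<Rightarrow> ('a \<Rightarrow> 'b) \<Rightarrow> 'b set set \<Rightarrow> 'a set set" where
  "pullback_cover X f \<U> = (\<lambda>U. {x \<in> topspace X. f x \<in> U}) ` \<U>"

text \<open>The homomorphism induced by a continuous map \<open>f\<close> from \<open>X\<close> to \<open>Y\<close>.\<close>

definition cech_map ::
    "'a topology \<Rightarrow> 'b topology \<Rightarrow> int \<Rightarrow> ('a \<Rightarrow> 'b) \<Rightarrow>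
     ('a set set \<Rightarrow> ('a set, 'k::field) chain set) \<Rightarrow> 'b set set \<Rightarrow> ('b set, 'k) chain set" where
  "cech_map X Y q f h =
     (\<lambda>\<U>\<in>{\<U>. open_cover Y \<U>}.
        homology_map (nerve \<U>) q
          (SOME p. cover_projection f (pullback_cover X f \<U>) \<U> p)
          (h (pullback_cover X f \<U>)))"


section \<open>Persistent Betti numbers\<close>

definition Delta_plus :: "((real^'n) \<times> (real^'n)) set" where
  "Delta_plus = {(u, v). \<forall>j. u $ j < v $ j}"

definition sublevel :: "'a topology \<Rightarrow> ('a \<Rightarrow> real^'n) \<Rightarrow> real^'n \<Rightarrow> 'a topology" where
  "sublevel X f u = subtopology X {p \<in> topspace X. \<forall>j. f p $ j \<le> u $ j}"

definition persistent_betti ::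
    "'k::field itself \<Rightarrow> 'a topology \<Rightarrow> ('a \<Rightarrow> real^'n) \<Rightarrow> int \<Rightarrow> real^'n \<Rightarrow> real^'n \<Rightarrow> enat" where
  "persistent_betti _ X f i u v =
     vs_dim ((cech_homology (sublevel X f v) i
                :: ('k, 'a set set \<Rightarrow> ('a set, 'k) chain set) module)
             \<lparr>carrier := cech_map (sublevel X f u) (sublevel X f v) i id
                           ` carrier (cech_homology (sublevel X f u) i)\<rparr>)"


section \<open>Triangulable spaces and the natural pseudodistance\<close>

text \<open>
  The ambient Euclidean space \<open>'m\<close> of the finite simplicial complex is a type parameter, since
  its dimension cannot be quantified inside the definition.
\<close>

definition triangulable :: "'m::euclidean_space itself \<Rightarrow> 'a topology \<Rightarrow> bool" where
  "triangulable _ X \<longleftrightarrow>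
     (\<exists>C :: 'm set set. simplicial_complex C \<and> X homeomorphic_space top_of_set (\<Union>C))"

text \<open>
  The max norm is \<^const>\<open>infnorm\<close>.  The supremum is the maximum whenever \<open>X\<close> is compact and
  nonempty and \<open>f\<close>, \<open>g\<close> are continuous.
\<close>

definition natural_pseudodistance ::
    "'a topology \<Rightarrow> ('a \<Rightarrow> real^'n) \<Rightarrow> 'b topology \<Rightarrow> ('b \<Rightarrow> real^'n) \<Rightarrow> ennreal" where
  "natural_pseudodistance X f Y g =
     (if X homeomorphic_space Y
      then INF h\<in>{h. homeomorphic_map X Y h}.
             SUP x\<in>topspace X. ennreal (infnorm (f x - g (h x)))
      else \<infinity>)"

end

theory Submission
  imports Defs
begin

text \<open>
  If the pseudodistance is smaller than the bound, some homeomorphism \<open>h\<close> changes the values of the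
  filtering functions by less than it, so \<open>h\<close> maps the sublevel set of \<open>u\<close> into that of \<open>u'\<close> and its
  inverse maps the sublevel set of \<open>v'\<close> into that of \<open>v\<close>.  The inclusion of sublevel sets in \<open>X\<close>
  therefore factors through the inclusion in \<open>Y\<close>, and by functoriality the rank of the first in
  homology is at most that of the second.  Functoriality of Cech homology rests on the fact that
  two projections between covers are contiguous and hence agree on the homology of the nerves.
\<close>

section \<open>Linear operators on chains\<close>

lemma lookup_chain_smult [simp]: "Poly_Mapping.lookup (chain_smult a c) s = a * Poly_Mapping.lookup c s"
  unfolding chain_smult_def by (simp add: Poly_Mapping.map.rep_eq when_def)

lemma chain_smult_add_right: "chain_smult a (c + d) = chain_smult a c + chain_smult a d"
  by (rule poly_mapping_eqI) (simp add: lookup_add algebra_simps)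

lemma chain_smult_diff_right: "chain_smult a (c - d) = chain_smult a c - chain_smult a d"
  by (rule poly_mapping_eqI) (simp add: lookup_minus algebra_simps)

lemma chain_smult_add_left: "chain_smult (a + b) c = chain_smult a c + chain_smult b c"
  by (rule poly_mapping_eqI) (simp add: lookup_add algebra_simps)

lemma chain_smult_assoc: "chain_smult a (chain_smult b c) = chain_smult (a * b) c"
  by (rule poly_mapping_eqI) (simp add: algebra_simps)

lemma chain_smult_zero_right [simp]: "chain_smult a 0 = 0"
  by (rule poly_mapping_eqI) simp

lemma chain_smult_zero_left [simp]: "chain_smult 0 c = 0"
  by (rule poly_mapping_eqI) simp

lemma chain_smult_one [simp]: "chain_smult 1 c = c"
  by (rule poly_mapping_eqI) simp

lemma chain_smult_minus_one: "chain_smult (- 1) c = - c"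
  by (rule poly_mapping_eqI) simp

lemma chain_smult_single: "chain_smult a (Poly_Mapping.single s b) = Poly_Mapping.single s (a * b)"
  by (rule poly_mapping_eqI) (simp add: lookup_single when_def)

lemma chain_smult_sum: "chain_smult a (sum F A) = (\<Sum>x\<in>A. chain_smult a (F x))"
  by (induction A rule: infinite_finite_induct) (auto simp: chain_smult_add_right)

lemma keys_chain_smult: "Poly_Mapping.keys (chain_smult a c) \<subseteq> Poly_Mapping.keys c"
  by (auto simp: in_keys_iff)

text \<open>Chain maps, boundary, cones and prisms are all instances, so additivity, composition and
  support bounds are proved once, and identities between operators are checked on
  generators.\<close>

definition linear_ext :: "('v list \<Rightarrow> ('w, 'k) chain) \<Rightarrow> ('v, 'k::field) chain \<Rightarrow> ('w, 'k) chain" where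
  "linear_ext F c = (\<Sum>s\<in>Poly_Mapping.keys c. chain_smult (Poly_Mapping.lookup c s) (F s))"

text \<open>Chains with different supports are summed over different index sets; over a common
  finite superset the extra coefficients are 0, and additivity and scaling become termwise.\<close>

lemma linear_ext_superset:
  assumes "finite A" "Poly_Mapping.keys c \<subseteq> A"
  shows "linear_ext F c = (\<Sum>s\<in>A. chain_smult (Poly_Mapping.lookup c s) (F s))"
  unfolding linear_ext_def using assms
  by (intro sum.mono_neutral_left) (auto simp: in_keys_iff)

lemma linear_ext_zero [simp]: "linear_ext F 0 = 0"
  by (simp add: linear_ext_def)

lemma linear_ext_add: "linear_ext F (c + d) = linear_ext F c + linear_ext F d"
proof -
  let ?A = "Poly_Mapping.keys c \<union> Poly_Mapping.keys d"
  have "Poly_Mapping.keys (c + d) \<subseteq> ?A" by (rule keys_add)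
  then show ?thesis
    by (simp add: linear_ext_superset[of ?A] lookup_add chain_smult_add_left sum.distrib)
qed

lemma linear_ext_smult: "linear_ext F (chain_smult a c) = chain_smult a (linear_ext F c)"
  by (simp add: linear_ext_superset[OF _ keys_chain_smult] chain_smult_sum chain_smult_assoc
        linear_ext_def[of F c])

lemma linear_ext_uminus: "linear_ext F (- c) = - linear_ext F c"
  using linear_ext_smult[of F "- 1" c] by (simp add: chain_smult_minus_one)

lemma linear_ext_diff: "linear_ext F (c - d) = linear_ext F c - linear_ext F d"
  using linear_ext_add[of F c "- d"] by (simp add: linear_ext_uminus)

lemma linear_ext_sum: "linear_ext F (sum G A) = (\<Sum>x\<in>A. linear_ext F (G x))"
  by (induction A rule: infinite_finite_induct) (auto simp: linear_ext_add)

lemma linear_ext_single [simp]: "linear_ext F (Poly_Mapping.single s a) = chain_smult a (F s)"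
  by (simp add: linear_ext_superset[of "{s}"])

lemma linear_ext_linear_ext: "linear_ext F (linear_ext G c) = linear_ext (\<lambda>s. linear_ext F (G s)) c"
  by (simp add: linear_ext_def[of _ c] linear_ext_sum linear_ext_smult)

lemma linear_ext_cong:
  "(\<And>s. s \<in> Poly_Mapping.keys c \<Longrightarrow> F s = G s) \<Longrightarrow> linear_ext F c = linear_ext G c"
  by (simp add: linear_ext_def)

lemma linear_ext_fun_diff: "linear_ext (\<lambda>s. F s - G s) c = linear_ext F c - linear_ext G c"
  by (simp add: linear_ext_def chain_smult_diff_right sum_subtractf)

lemma linear_ext_generators [simp]: "linear_ext (\<lambda>s. Poly_Mapping.single s 1) c = c"
  by (rule poly_mapping_eqI)
    (simp add: linear_ext_def lookup_sum lookup_single when_def in_keys_iff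
        if_distrib[of "(*) (_ :: 'b)"] cong: if_cong)

lemma keys_linear_ext:
  "Poly_Mapping.keys (linear_ext F c) \<subseteq> (\<Union>s\<in>Poly_Mapping.keys c. Poly_Mapping.keys (F s))"
proof -
  have "Poly_Mapping.keys (linear_ext F c)
      \<subseteq> (\<Union>s\<in>Poly_Mapping.keys c. Poly_Mapping.keys (chain_smult (Poly_Mapping.lookup c s) (F s)))"
    unfolding linear_ext_def by (rule keys_sum)
  also have "\<dots> \<subseteq> (\<Union>s\<in>Poly_Mapping.keys c. Poly_Mapping.keys (F s))"
    using keys_chain_smult by blast
  finally show ?thesis .
qed

section \<open>Chain maps and the boundary as linear extensions\<close>

lemma chain_map_linear_ext: "chain_map p = linear_ext (\<lambda>s. Poly_Mapping.single (map p s) 1)"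
  by (rule ext) (simp add: chain_map_def linear_ext_def chain_smult_single)

lemmas chain_map_add = linear_ext_add[of "\<lambda>s. Poly_Mapping.single (map p s) 1" for p,
    folded chain_map_linear_ext]

lemma chain_map_chain_map: "chain_map p (chain_map r c) = chain_map (p \<circ> r) c"
  by (simp add: chain_map_linear_ext linear_ext_linear_ext)

text \<open>The boundary of one generator; the case split is the unaugmented convention of
  \<open>boundary\<close>.\<close>

definition faces :: "'v list \<Rightarrow> ('v, 'k::field) chain" where
  "faces s = (if length s \<le> 1 then 0
     else \<Sum>j<length s. Poly_Mapping.single (take j s @ drop (Suc j) s) ((-1) ^ j))"

lemma boundary_linear_ext: "boundary = linear_ext faces"
  unfolding boundary_def linear_ext_def faces_def
  by (intro ext sum.cong refl) (simp add: chain_smult_sum chain_smult_single mult.commute)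

text \<open>Deleting a position commutes with \<open>map p\<close>. Lists with repeated vertices are
  still generators, so a map that is not injective creates no degenerate case.\<close>

lemma faces_map: "chain_map p (faces s) = faces (map p s)"
  by (simp add: faces_def chain_map_linear_ext linear_ext_sum chain_smult_single take_map drop_map)

lemma boundary_chain_map: "boundary (chain_map p c) = chain_map p (boundary c)"
  unfolding boundary_linear_ext chain_map_linear_ext linear_ext_linear_ext
  by (simp add: faces_map[unfolded chain_map_linear_ext])


section \<open>The prism operator\<close>

text \<open>The algebraic cone; whether the longer lists still span simplices is tracked separately,
  through supports.\<close>

definition cone_over :: "'v \<Rightarrow> ('v, 'k::field) chain \<Rightarrow> ('v, 'k) chain" where
  "cone_over a = linear_ext (\<lambda>s. Poly_Mapping.single (a # s) 1)"

lemma cone_over_single [simp]: "cone_over a (Poly_Mapping.single s b) = Poly_Mapping.single (a # s) b"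
  by (simp add: cone_over_def chain_smult_single)

lemma cone_over_zero [simp]: "cone_over a 0 = 0"
  by (simp add: cone_over_def)

lemma cone_over_diff: "cone_over a (c - d) = cone_over a c - cone_over a d"
  by (simp add: cone_over_def linear_ext_diff)

text \<open>The boundary of the augmented complex, in which the faces of a one-element list are
  the empty list, has a uniform recursion along the list.\<close>

primrec aug_faces :: "'v list \<Rightarrow> ('v, 'k::field) chain" where
  "aug_faces [] = 0"
| "aug_faces (a # s) = Poly_Mapping.single s 1 - cone_over a (aug_faces s)"

text \<open>Deleting the head is the term \<open>j = 0\<close>; deletions in the tail move up by one
  position, which accounts for the minus sign in the recursion.\<close>

lemma aug_faces_sum:
  "(aug_faces s :: ('v, 'k::field) chain) = (\<Sum>j<length s. Poly_Mapping.single (take j s @ drop (Suc j) s) ((-1) ^ j))"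
proof (induction s)
  case (Cons a s)
  have "(cone_over a (aug_faces s) :: ('v, 'k) chain)
      = (\<Sum>j<length s. Poly_Mapping.single (a # take j s @ drop (Suc j) s) ((-1) ^ j))"
    unfolding Cons.IH by (simp add: cone_over_def linear_ext_sum chain_smult_single)
  then show ?case
    by (simp add: sum.lessThan_Suc_shift single_uminus sum_negf del: sum.lessThan_Suc)
qed simp

lemma faces_eq_aug_faces: "2 \<le> length s \<Longrightarrow> faces s = aug_faces s"
  by (simp add: faces_def aug_faces_sum)

lemma aug_faces_map: "chain_map p (aug_faces s) = aug_faces (map p s)"
  by (simp add: aug_faces_sum chain_map_linear_ext linear_ext_sum chain_smult_single take_map drop_map)

text \<open>The cone formula. Thanks to the augmentation it holds uniformly, also on one-element
  lists and the empty list.\<close>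

lemma aug_boundary_cone_over: "linear_ext aug_faces (cone_over a c) = c - cone_over a (linear_ext aug_faces c)"
  by (simp add: cone_over_def linear_ext_linear_ext linear_ext_fun_diff)

text \<open>
  Recursive form of the alternating sum of
  \<open>[p s\<^sub>0, \<dots>, p s\<^sub>j, p' s\<^sub>j, \<dots>, p' s\<^sub>q]\<close>.
\<close>

primrec prism :: "('v \<Rightarrow> 'w) \<Rightarrow> ('v \<Rightarrow> 'w) \<Rightarrow> 'v list \<Rightarrow> ('w, 'k::field) chain" where
  "prism p p' [] = 0"
| "prism p p' (a # s) = Poly_Mapping.single (p a # p' a # map p' s) 1 - cone_over (p a) (prism p p' s)"

lemma prism_cone_over:
  "linear_ext (prism p p') (cone_over a c)
     = cone_over (p a) (cone_over (p' a) (chain_map p' c)) - cone_over (p a) (linear_ext (prism p p') c)"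
  by (simp add: cone_over_def linear_ext_linear_ext chain_map_linear_ext linear_ext_fun_diff)

text \<open>The homotopy formula, by induction with the cone formulas. In the step, the inner face
  \<open>p a # map p' s\<close> arises twice with opposite signs: from the leading term, and from
  the induction hypothesis under the cone.\<close>

lemma aug_boundary_prism:
  "linear_ext aug_faces (prism p p' s)
     = Poly_Mapping.single (map p' s) 1 - Poly_Mapping.single (map p s) 1
       - linear_ext (prism p p') (aug_faces s)"
  by (induction s)
    (simp_all add: linear_ext_diff aug_boundary_cone_over prism_cone_over cone_over_diff aug_faces_map)

lemma keys_cone_over: "Poly_Mapping.keys (cone_over a c) \<subseteq> (#) a ` Poly_Mapping.keys c"
  using keys_linear_ext[of "\<lambda>s. Poly_Mapping.single (a # s) 1" c]
  by (simp add: cone_over_def UNION_singleton_eq_range)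

text \<open>The length gives the degree shift of the homotopy; the vertex bound is what contiguity
  turns into membership in the target complex.\<close>

lemma keys_prism:
  "Poly_Mapping.keys (prism p p' s :: ('w, 'k::field) chain)
     \<subseteq> {t. length t = Suc (length s) \<and> set t \<subseteq> p ` set s \<union> p' ` set s}"
proof (induction s)
  case (Cons a s)
  show ?case
  proof
    fix t assume "t \<in> Poly_Mapping.keys (prism p p' (a # s) :: ('w, 'k) chain)"
    then have "t = p a # p' a # map p' s
        \<or> t \<in> Poly_Mapping.keys (cone_over (p a) (prism p p' s) :: ('w, 'k) chain)"
      using keys_diff[of "Poly_Mapping.single (p a # p' a # map p' s) (1::'k)"
          "cone_over (p a) (prism p p' s)"] by auto
    moreover have "length t = Suc (length (a # s)) \<and> set t \<subseteq> p ` set (a # s) \<union> p' ` set (a # s)"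
      if t: "t \<in> Poly_Mapping.keys (cone_over (p a) (prism p p' s) :: ('w, 'k) chain)"
    proof -
      obtain r where "t = p a # r" and r: "r \<in> Poly_Mapping.keys (prism p p' s :: ('w, 'k) chain)"
        using subsetD[OF keys_cone_over t] by (rule imageE)
      moreover have "length r = Suc (length s) \<and> set r \<subseteq> p ` set s \<union> p' ` set s"
        using subsetD[OF Cons.IH r] by (rule CollectD)
      ultimately show ?thesis by auto
    qed
    ultimately show "t \<in> {t. length t = Suc (length (a # s)) \<and> set t \<subseteq> p ` set (a # s) \<union> p' ` set (a # s)}"
      by auto
  qed
qed simp

text \<open>The augmented formula carries over: prisms contain only lists of length at least 2,
  where both boundaries agree, and on shorter arguments \<open>prism\<close> kills the
  difference.\<close>

lemma boundary_prism:
  "(boundary (linear_ext (prism p p') c) :: ('w, 'k::field) chain)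
     = chain_map p' c - chain_map p c - linear_ext (prism p p') (boundary c)"
proof -
  have 1: "linear_ext faces (prism p p' s) = linear_ext aug_faces (prism p p' s :: ('w, 'k) chain)" for s
  proof (rule linear_ext_cong)
    fix t assume "t \<in> Poly_Mapping.keys (prism p p' s :: ('w, 'k) chain)"
    then have "2 \<le> length t" using subsetD[OF keys_prism] by (cases s) fastforce+
    then show "faces t = (aug_faces t :: ('w, 'k) chain)" by (rule faces_eq_aug_faces)
  qed
  \<comment> \<open>On \<open>[a]\<close> the two boundaries differ by the generator
    \<open>[]\<close>, and \<open>prism p p' [] = 0\<close>.\<close>
  have 2: "linear_ext (prism p p') (faces s)
      = (linear_ext (prism p p') (aug_faces s) :: ('w, 'k) chain)" for s
  proof (cases "2 \<le> length s")
    case False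
    then consider "s = []" | a where "s = [a]"
      by (cases s; cases "tl s") auto
    then show ?thesis
      by cases (simp_all add: faces_def)
  qed (simp add: faces_eq_aug_faces)
  show ?thesis
    unfolding boundary_linear_ext linear_ext_linear_ext chain_map_linear_ext 1 2
      aug_boundary_prism linear_ext_fun_diff ..
qed

section \<open>Homology classes and induced maps\<close>

lemma zero_in_chains [simp]: "0 \<in> chains K q"
  by (simp add: chains_def)

lemma chains_add: "c \<in> chains K q \<Longrightarrow> d \<in> chains K q \<Longrightarrow> c + d \<in> chains K q"
  unfolding chains_def by (blast dest: subsetD[OF keys_add])

lemma chains_smult: "c \<in> chains K q \<Longrightarrow> chain_smult a c \<in> chains K q"
  unfolding chains_def by (blast dest: subsetD[OF keys_chain_smult])

lemma linear_ext_in_chains: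
  assumes "c \<in> chains K q"
    and "\<And>s. int (length s) = q + 1 \<Longrightarrow> set s \<in> K \<Longrightarrow> F s \<in> chains L r"
  shows "linear_ext F c \<in> chains L r"
  using assms unfolding chains_def by (blast dest: subsetD[OF keys_linear_ext])

lemmas boundary_add = linear_ext_add[of faces, folded boundary_linear_ext]
lemmas boundary_smult = linear_ext_smult[of faces, folded boundary_linear_ext]

lemma zero_in_boundaries [simp]: "0 \<in> boundaries K q"
  unfolding boundaries_def by (rule image_eqI[of _ _ 0]) (simp_all add: boundary_linear_ext)

lemma boundaries_add:
  "b \<in> boundaries K q \<Longrightarrow> d \<in> boundaries K q \<Longrightarrow> b + d \<in> boundaries K q"
  unfolding boundaries_def by (auto simp: boundary_add[symmetric] chains_add)

lemma boundaries_smult: "b \<in> boundaries K q \<Longrightarrow> chain_smult a b \<in> boundaries K q"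
  unfolding boundaries_def by (auto simp: boundary_smult[symmetric] chains_smult)

lemma boundaries_uminus: "b \<in> boundaries K q \<Longrightarrow> - b \<in> boundaries K q"
  using boundaries_smult[of b K q "- 1"] by (simp add: chain_smult_minus_one)

lemma zero_in_cycles [simp]: "0 \<in> cycles K q"
  by (simp add: cycles_def boundary_linear_ext)

lemma cycles_add: "y \<in> cycles K q \<Longrightarrow> z \<in> cycles K q \<Longrightarrow> y + z \<in> cycles K q"
  by (simp add: cycles_def chains_add boundary_add)

lemma cycles_smult: "z \<in> cycles K q \<Longrightarrow> chain_smult a z \<in> cycles K q"
  by (simp add: cycles_def chains_smult boundary_smult)

text \<open>Naming the cosets that form the carrier reduces the set-level operations of
  \<open>simplicial_homology\<close> to computations with representatives.\<close>

definition homology_class :: "'v set set \<Rightarrow> int \<Rightarrow> ('v, 'k::field) chain \<Rightarrow> ('v, 'k) chain set" where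
  "homology_class K q z = {z + b | b. b \<in> boundaries K q}"

lemma homology_class_zero: "homology_class K q 0 = boundaries K q"
  by (simp add: homology_class_def)

text \<open>The difference is absorbed into the added boundary; the reverse inclusion uses the
  negated difference.\<close>

lemma homology_class_eqI:
  assumes "y - z \<in> boundaries K q"
  shows "homology_class K q y = homology_class K q z"
proof -
  have *: "homology_class K q y \<subseteq> homology_class K q z"
    if "y - z \<in> boundaries K q" for y z :: "('a, 'b) chain"
  proof
    fix x assume "x \<in> homology_class K q y"
    then obtain b where "x = z + ((y - z) + b)" "b \<in> boundaries K q"
      by (auto simp: homology_class_def)
    then show "x \<in> homology_class K q z"
      unfolding homology_class_def using boundaries_add[OF that] by blast
  qed
  show ?thesis
    using *[OF assms] *[of z y] boundaries_uminus[OF assms] by auto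
qed

lemma carrier_simplicial_homology:
  "carrier (simplicial_homology K q) = homology_class K q ` cycles K q"
  by (simp add: simplicial_homology_def homology_class_def)

lemma zero_simplicial_homology: "\<zero>\<^bsub>simplicial_homology K q\<^esub> = homology_class K q 0"
  by (simp add: simplicial_homology_def homology_class_zero)

lemma add_simplicial_homology:
  "homology_class K q y \<oplus>\<^bsub>simplicial_homology K q\<^esub> homology_class K q z = homology_class K q (y + z)"
proof -
  have "{a + b |a b. a \<in> homology_class K q y \<and> b \<in> homology_class K q z} = homology_class K q (y + z)"
    (is "?L = ?R")
  proof
    show "?L \<subseteq> ?R"
    proof
      fix x assume "x \<in> ?L"
      then obtain b d where "x = (y + b) + (z + d)" "b \<in> boundaries K q" "d \<in> boundaries K q"
        by (auto simp: homology_class_def)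
      then have "x = (y + z) + (b + d)" "b + d \<in> boundaries K q"
        by (auto simp: algebra_simps boundaries_add)
      then show "x \<in> ?R" unfolding homology_class_def by blast
    qed
    show "?R \<subseteq> ?L"
    proof
      fix x assume "x \<in> ?R"
      then obtain b where "x = (y + b) + (z + 0)" "b \<in> boundaries K q"
        by (auto simp: homology_class_def algebra_simps)
      then show "x \<in> ?L" unfolding homology_class_def using zero_in_boundaries by blast
    qed
  qed
  then show ?thesis by (simp add: simplicial_homology_def)
qed

text \<open>Scaling a coset by 0 gives only the zero chain; the boundaries added in the definition
  of the scalar action restore a full coset.\<close>

lemma smult_simplicial_homology:
  "a \<odot>\<^bsub>simplicial_homology K q\<^esub> homology_class K q z = homology_class K q (chain_smult a z)"
proof -
  have "{chain_smult a y + b |y b. y \<in> homology_class K q z \<and> b \<in> boundaries K q}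
      = homology_class K q (chain_smult a z)" (is "?L = ?R")
  proof
    show "?L \<subseteq> ?R"
    proof
      fix x assume "x \<in> ?L"
      then obtain b d where "x = chain_smult a (z + b) + d" "b \<in> boundaries K q" "d \<in> boundaries K q"
        by (auto simp: homology_class_def)
      then have "x = chain_smult a z + (chain_smult a b + d)" "chain_smult a b + d \<in> boundaries K q"
        by (auto simp: algebra_simps chain_smult_add_right boundaries_add boundaries_smult)
      then show "x \<in> ?R" unfolding homology_class_def by blast
    qed
    show "?R \<subseteq> ?L"
    proof
      fix x assume "x \<in> ?R"
      then obtain b where "x = chain_smult a (z + 0) + b" "b \<in> boundaries K q"
        by (auto simp: homology_class_def)
      then show "x \<in> ?L" unfolding homology_class_def using zero_in_boundaries by blast
    qed
  qed
  then show ?thesis by (simp add: simplicial_homology_def)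
qed

section \<open>Simplicial maps, their action on homology, and contiguity\<close>

definition simplicial_map :: "'v set set \<Rightarrow> 'w set set \<Rightarrow> ('v \<Rightarrow> 'w) \<Rightarrow> bool" where
  "simplicial_map K L p \<longleftrightarrow> (\<forall>\<sigma>\<in>K. p ` \<sigma> \<in> L)"

lemma chain_map_chains:
  "simplicial_map K L p \<Longrightarrow> c \<in> chains K q \<Longrightarrow> chain_map p c \<in> chains L q"
  unfolding chain_map_linear_ext
  by (erule linear_ext_in_chains) (auto simp: chains_def simplicial_map_def)

lemma chain_map_cycles:
  "simplicial_map K L p \<Longrightarrow> z \<in> cycles K q \<Longrightarrow> chain_map p z \<in> cycles L q"
  by (simp add: cycles_def chain_map_chains boundary_chain_map) (simp add: chain_map_linear_ext)

lemma chain_map_boundaries: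
  "simplicial_map K L p \<Longrightarrow> b \<in> boundaries K q \<Longrightarrow> chain_map p b \<in> boundaries L q"
  unfolding boundaries_def by (auto simp: boundary_chain_map[symmetric] chain_map_chains)

text \<open>Images of boundaries are boundaries of \<open>L\<close>, and those added in
  \<open>homology_map\<close> fill the image up to a whole coset.\<close>

lemma homology_map_class:
  assumes "simplicial_map K L p"
  shows "homology_map L q p (homology_class K q z) = homology_class L q (chain_map p z)"
    (is "?L = ?R")
proof
  show "?L \<subseteq> ?R"
  proof
    fix x assume "x \<in> ?L"
    then obtain b d where "x = chain_map p z + (chain_map p b + d)"
      "b \<in> boundaries K q" "d \<in> boundaries L q"
      by (auto simp: homology_class_def homology_map_def chain_map_add algebra_simps)
    then show "x \<in> ?R"
      unfolding homology_class_def using chain_map_boundaries[OF assms] boundaries_add by blast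
  qed
  show "?R \<subseteq> ?L"
  proof
    fix x assume "x \<in> ?R"
    then obtain b where "x = chain_map p (z + 0) + b" "b \<in> boundaries L q"
      by (auto simp: homology_class_def)
    then show "x \<in> ?L"
      unfolding homology_class_def homology_map_def using zero_in_boundaries by blast
  qed
qed

lemma homology_map_in_carrier:
  assumes "simplicial_map K L p" "A \<in> carrier (simplicial_homology K q)"
  shows "homology_map L q p A \<in> carrier (simplicial_homology L q)"
  using assms by (auto simp: carrier_simplicial_homology homology_map_class chain_map_cycles)

lemma homology_map_comp:
  assumes "simplicial_map K L p" "simplicial_map L M r" "A \<in> carrier (simplicial_homology K q)"
  shows "homology_map M q r (homology_map L q p A) = homology_map M q (r \<circ> p) A"
proof -
  have "simplicial_map K M (r \<circ> p)"
    using assms(1,2) unfolding simplicial_map_def image_comp[symmetric] by blast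
  then show ?thesis
    using assms by (auto simp: carrier_simplicial_homology homology_map_class chain_map_chain_map)
qed

lemma homology_map_add:
  assumes "simplicial_map K L p" "A \<in> carrier (simplicial_homology K q)"
    "B \<in> carrier (simplicial_homology K q)"
  shows "homology_map L q p (A \<oplus>\<^bsub>simplicial_homology K q\<^esub> B)
    = homology_map L q p A \<oplus>\<^bsub>simplicial_homology L q\<^esub> homology_map L q p B"
  using assms
  by (auto simp: carrier_simplicial_homology homology_map_class add_simplicial_homology chain_map_add)

lemma homology_map_smult:
  assumes "simplicial_map K L p" "A \<in> carrier (simplicial_homology K q)"
  shows "homology_map L q p (a \<odot>\<^bsub>simplicial_homology K q\<^esub> A)
    = a \<odot>\<^bsub>simplicial_homology L q\<^esub> homology_map L q p A"
  using assms
  by (auto simp: carrier_simplicial_homology homology_map_class smult_simplicial_homology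
      chain_map_linear_ext linear_ext_smult)

lemma homology_map_zero:
  assumes "simplicial_map K L p"
  shows "homology_map L q p \<zero>\<^bsub>simplicial_homology K q\<^esub> = \<zero>\<^bsub>simplicial_homology L q\<^esub>"
  using assms by (simp add: zero_simplicial_homology homology_map_class) (simp add: chain_map_linear_ext)

text \<open>Contiguity places every prism over a simplex of \<open>K\<close> in \<open>L\<close>, so
  the prism operator is a chain homotopy and the two images of a cycle differ by a boundary.\<close>

lemma homology_map_contiguous:
  assumes "simplicial_map K L p" "simplicial_map K L p'" "A \<in> carrier (simplicial_homology K q)"
    and contiguous: "\<And>\<sigma> \<tau>. \<sigma> \<in> K \<Longrightarrow> \<tau> \<subseteq> p ` \<sigma> \<union> p' ` \<sigma> \<Longrightarrow> \<tau> \<noteq> {} \<Longrightarrow> \<tau> \<in> L"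
  shows "homology_map L q p A = homology_map L q p' A"
proof -
  obtain z where z: "z \<in> cycles K q" and A: "A = homology_class K q z"
    using assms(3) by (auto simp: carrier_simplicial_homology)
  \<comment> \<open>With \<open>p'\<close> first, the homotopy formula yields
    \<open>chain_map p z - chain_map p' z\<close>, since the term with \<open>boundary z\<close>
    vanishes.\<close>
  have "linear_ext (prism p' p) z \<in> chains L (q + 1)"
  proof (rule linear_ext_in_chains)
    show "z \<in> chains K q" using z by (simp add: cycles_def)
    fix s assume s: "int (length s) = q + 1" "set s \<in> K"
    have "int (length t) = (q + 1) + 1 \<and> set t \<in> L"
      if "t \<in> Poly_Mapping.keys (prism p' p s :: ('b, 'c) chain)" for t
      using subsetD[OF keys_prism that] s contiguous[of "set s" "set t"]
      by (cases t) (auto simp: Un_commute)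
    then show "(prism p' p s :: ('b, 'c) chain) \<in> chains L (q + 1)"
      by (simp add: chains_def)
  qed
  moreover have "boundary (linear_ext (prism p' p) z) = chain_map p z - chain_map p' z"
    using z by (simp add: boundary_prism cycles_def)
  ultimately have "chain_map p z - chain_map p' z \<in> boundaries L q"
    unfolding boundaries_def by (metis image_eqI)
  then show ?thesis
    using assms(1,2) by (simp add: A homology_map_class homology_class_eqI)
qed

text \<open>The monoid laws govern the finite sums in \<open>lin_independent\<close>; each reduces
  to addition of representatives.\<close>

lemma abelian_monoid_simplicial_homology: "abelian_monoid (simplicial_homology K q)"
proof (rule abelian_monoidI)
qed (auto simp: carrier_simplicial_homology zero_simplicial_homology add_simplicial_homology
    cycles_add ac_simps)

lemma simplicial_homology_smult_closed:
  "A \<in> carrier (simplicial_homology K q) \<Longrightarrow>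
   a \<odot>\<^bsub>simplicial_homology K q\<^esub> A \<in> carrier (simplicial_homology K q)"
  by (auto simp: carrier_simplicial_homology smult_simplicial_homology cycles_smult)

section \<open>Functoriality of Cech homology\<close>

text \<open>If \<open>x\<close> is a common point of the members of \<open>\<sigma>\<close>, then
  \<open>f x\<close> is one of the members of \<open>\<tau>\<close>. Taking \<open>p = p'\<close>
  gives simpliciality, the general case gives contiguity.\<close>

lemma projection_image_in_nerve:
  assumes "cover_projection f \<V> \<U> p" "cover_projection f \<V> \<U> p'"
    and \<sigma>: "\<sigma> \<in> nerve \<V>" and \<tau>: "\<tau> \<subseteq> p ` \<sigma> \<union> p' ` \<sigma>" "\<tau> \<noteq> {}"
  shows "\<tau> \<in> nerve \<U>"
proof -
  obtain x where x: "\<And>V. V \<in> \<sigma> \<Longrightarrow> x \<in> V" and fin: "finite \<sigma>" and sub: "\<sigma> \<subseteq> \<V>"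
    using \<sigma> by (auto simp: nerve_def)
  have "T \<in> \<U> \<and> f x \<in> T" if T: "T \<in> \<tau>" for T
  proof -
    obtain V where "V \<in> \<sigma>" "T = p V \<or> T = p' V" using T \<tau>(1) by blast
    moreover from this have V: "V \<in> \<V>" "x \<in> V" using x sub by auto
    then have "V \<noteq> {}" by blast
    with V(1) have "p V \<in> \<U> \<and> f ` V \<subseteq> p V" "p' V \<in> \<U> \<and> f ` V \<subseteq> p' V"
      using assms(1,2) by (simp_all add: cover_projection_def)
    ultimately show ?thesis
      using imageI[OF V(2), of f] by auto
  qed
  moreover have "finite \<tau>" using fin \<tau>(1) by (auto intro: finite_subset)
  ultimately show ?thesis using \<tau>(2) unfolding nerve_def by blast
qed

lemma cover_projection_simplicial_map:
  assumes "cover_projection f \<V> \<U> p"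
  shows "simplicial_map (nerve \<V>) (nerve \<U>) p"
  unfolding simplicial_map_def
proof
  fix \<sigma> assume "\<sigma> \<in> nerve \<V>"
  moreover from this have "p ` \<sigma> \<noteq> {}" by (simp add: nerve_def)
  ultimately show "p ` \<sigma> \<in> nerve \<U>"
    using projection_image_in_nerve[OF assms assms] by blast
qed

text \<open>This makes the choice of projection in \<open>cech_map\<close> immaterial.\<close>

lemma homology_map_projections_eq:
  assumes "cover_projection f \<V> \<U> p" "cover_projection f \<V> \<U> p'"
    and "A \<in> carrier (simplicial_homology (nerve \<V>) q)"
  shows "homology_map (nerve \<U>) q p A = homology_map (nerve \<U>) q p' A"
  by (rule homology_map_contiguous[OF cover_projection_simplicial_map[OF assms(1)]
        cover_projection_simplicial_map[OF assms(2)] assms(3)])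
    (rule projection_image_in_nerve[OF assms(1,2)])

lemma cover_projection_comp:
  assumes "cover_projection f \<V> \<U> p" "cover_projection g \<U> \<W> r"
  shows "cover_projection (g \<circ> f) \<V> \<W> (r \<circ> p)"
  unfolding cover_projection_def
proof (intro ballI impI)
  fix V assume "V \<in> \<V>" "V \<noteq> {}"
  then have V: "p V \<in> \<U>" "f ` V \<subseteq> p V" using assms(1) by (simp_all add: cover_projection_def)
  \<comment> \<open>Projections are constrained only on nonempty members, so this is what lets
    \<open>r\<close> be applied to \<open>p V\<close>.\<close>
  then have "p V \<noteq> {}" using \<open>V \<noteq> {}\<close> by auto
  then have "r (p V) \<in> \<W>" "g ` p V \<subseteq> r (p V)" using V assms(2) by (simp_all add: cover_projection_def)
  then show "(r \<circ> p) V \<in> \<W> \<and> (g \<circ> f) ` V \<subseteq> (r \<circ> p) V" using V by auto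
qed

lemma homology_map_projection_comp:
  assumes "cover_projection f \<V> \<U> p" "cover_projection g \<U> \<W> r"
    and "A \<in> carrier (simplicial_homology (nerve \<V>) q)"
  shows "homology_map (nerve \<W>) q r (homology_map (nerve \<U>) q p A)
    = homology_map (nerve \<W>) q (r \<circ> p) A"
  by (rule homology_map_comp[OF cover_projection_simplicial_map[OF assms(1)]
        cover_projection_simplicial_map[OF assms(2)] assms(3)])

section \<open>Pullback covers and induced maps on the inverse limit\<close>

lemma open_cover_pullback:
  assumes "continuous_map X Y f" "open_cover Y \<U>"
  shows "open_cover X (pullback_cover X f \<U>)"
proof -
  have \<U>: "\<And>U. U \<in> \<U> \<Longrightarrow> openin Y U" "\<Union>\<U> = topspace Y"
    using assms(2) by (simp_all add: open_cover_def)
  have "\<exists>U\<in>\<U>. f x \<in> U" if "x \<in> topspace X" for x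
    using continuous_map_funspace[OF assms(1)] that \<U>(2) by blast
  then have "\<Union>(pullback_cover X f \<U>) = topspace X"
    unfolding pullback_cover_def by blast
  moreover have "openin X {x \<in> topspace X. f x \<in> U}" if "U \<in> \<U>" for U
    using openin_continuous_map_preimage[OF assms(1) \<U>(1)[OF that]] .
  ultimately show ?thesis
    unfolding open_cover_def by (simp add: pullback_cover_def)
qed

text \<open>Justifies the \<open>SOME\<close> in \<open>cech_map\<close>: each member is the
  preimage of some \<open>U\<close>, and one such \<open>U\<close> is chosen for it.\<close>

lemma cover_projection_pullback:
  "cover_projection f (pullback_cover X f \<U>) \<U> (SOME p. cover_projection f (pullback_cover X f \<U>) \<U> p)"
proof (rule someI_ex[of "cover_projection f (pullback_cover X f \<U>) \<U>"])
  have "\<forall>V\<in>pullback_cover X f \<U>. \<exists>U. U \<in> \<U> \<and> f ` V \<subseteq> U"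
    by (auto simp: pullback_cover_def)
  from bchoice[OF this] obtain p where "\<forall>V\<in>pullback_cover X f \<U>. p V \<in> \<U> \<and> f ` V \<subseteq> p V" ..
  then show "\<exists>p. cover_projection f (pullback_cover X f \<U>) \<U> p"
    unfolding cover_projection_def by blast
qed

lemma cech_homology_component:
  "h \<in> carrier (cech_homology X q) \<Longrightarrow> open_cover X \<U> \<Longrightarrow>
   h \<U> \<in> carrier (simplicial_homology (nerve \<U>) q)"
  by (auto simp: cech_homology_def)

lemma cech_homology_compatible:
  "h \<in> carrier (cech_homology X q) \<Longrightarrow> open_cover X \<U> \<Longrightarrow> open_cover X \<V> \<Longrightarrow>
   cover_projection id \<V> \<U> p \<Longrightarrow> homology_map (nerve \<U>) q p (h \<V>) = h \<U>"
  by (auto simp: cech_homology_def)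

lemma in_carrier_cech_homologyI:
  assumes "h \<in> extensional {\<U>. open_cover X \<U>}"
    and "\<And>\<U>. open_cover X \<U> \<Longrightarrow> h \<U> \<in> carrier (simplicial_homology (nerve \<U>) q)"
    and "\<And>\<U> \<V> p. open_cover X \<U> \<Longrightarrow> open_cover X \<V> \<Longrightarrow> cover_projection id \<V> \<U> p \<Longrightarrow>
      homology_map (nerve \<U>) q p (h \<V>) = h \<U>"
  shows "h \<in> carrier (cech_homology X q)"
  using assms by (auto simp: cech_homology_def PiE_iff)

lemma cech_homology_eqI:
  assumes "h \<in> carrier (cech_homology X q)" "h' \<in> carrier (cech_homology X q)"
    and "\<And>\<U>. open_cover X \<U> \<Longrightarrow> h \<U> = h' \<U>"
  shows "h = h'"
  by (rule extensionalityI[of _ "{\<U>. open_cover X \<U>}"])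
    (use assms in \<open>auto simp: cech_homology_def PiE_iff\<close>)

text \<open>A component may be computed from any open cover of \<open>X\<close> that projects to
  \<open>\<U>\<close> along \<open>f\<close>: such a cover refines the pullback cover, the family
  \<open>h\<close> is compatible with refinement, and projections agree on homology. Functoriality
  follows from this freedom.\<close>

lemma cech_map_component:
  assumes f: "continuous_map X Y f" and h: "h \<in> carrier (cech_homology X q)"
    and \<U>: "open_cover Y \<U>" and \<V>: "open_cover X \<V>" and p: "cover_projection f \<V> \<U> p"
  shows "cech_map X Y q f h \<U> = homology_map (nerve \<U>) q p (h \<V>)"
proof -
  let ?W = "pullback_cover X f \<U>"
  let ?r = "\<lambda>V. {x \<in> topspace X. f x \<in> p V}" and ?s = "SOME p. cover_projection f ?W \<U> p"
  \<comment> \<open>Since \<open>f\<close> maps \<open>V\<close> into \<open>p V\<close>, the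
    preimage of \<open>p V\<close> is a member of the pullback cover containing
    \<open>V\<close>.\<close>
  have r: "cover_projection id \<V> ?W ?r"
    unfolding cover_projection_def
  proof (intro ballI impI)
    fix V assume V: "V \<in> \<V>" "V \<noteq> {}"
    then have "p V \<in> \<U>" "f ` V \<subseteq> p V" using p by (simp_all add: cover_projection_def)
    moreover have "V \<subseteq> topspace X" using V(1) \<V> by (simp add: open_cover_def openin_subset)
    ultimately show "?r V \<in> ?W \<and> id ` V \<subseteq> ?r V"
      unfolding pullback_cover_def by auto
  qed
  have "cech_map X Y q f h \<U> = homology_map (nerve \<U>) q ?s (h ?W)"
    using \<U> by (simp add: cech_map_def)
  also have "h ?W = homology_map (nerve ?W) q ?r (h \<V>)"
    using cech_homology_compatible[OF h open_cover_pullback[OF f \<U>] \<V> r] by simp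
  also have "homology_map (nerve \<U>) q ?s \<dots> = homology_map (nerve \<U>) q (?s \<circ> ?r) (h \<V>)"
    by (rule homology_map_projection_comp[OF r cover_projection_pullback cech_homology_component[OF h \<V>]])
  also have "\<dots> = homology_map (nerve \<U>) q p (h \<V>)"
    using homology_map_projections_eq[OF _ p cech_homology_component[OF h \<V>]]
      cover_projection_comp[OF r cover_projection_pullback] by simp
  finally show ?thesis .
qed

lemmas cech_map_pullback = cech_map_component[OF _ _ _ open_cover_pullback cover_projection_pullback]

text \<open>For compatibility, the chosen projection to \<open>\<V>\<close> followed by the
  refinement \<open>r\<close> is another projection along \<open>f\<close> to \<open>\<U>\<close>,
  so it computes the component at \<open>\<U>\<close>.\<close>

lemma cech_map_in_carrier:
  assumes f: "continuous_map X Y f" and h: "h \<in> carrier (cech_homology X q)"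
  shows "cech_map X Y q f h \<in> carrier (cech_homology Y q)"
proof (rule in_carrier_cech_homologyI)
  show "cech_map X Y q f h \<in> extensional {\<U>. open_cover Y \<U>}"
    by (simp add: cech_map_def)
next
  fix \<U> assume \<U>: "open_cover Y \<U>"
  show "cech_map X Y q f h \<U> \<in> carrier (simplicial_homology (nerve \<U>) q)"
    unfolding cech_map_pullback[OF f h \<U> f \<U>]
    by (rule homology_map_in_carrier[OF cover_projection_simplicial_map[OF cover_projection_pullback]
          cech_homology_component[OF h open_cover_pullback[OF f \<U>]]])
next
  fix \<U> \<V> r assume \<U>: "open_cover Y \<U>" and \<V>: "open_cover Y \<V>" and r: "cover_projection id \<V> \<U> r"
  have "cover_projection f (pullback_cover X f \<V>) \<U>
      (r \<circ> (SOME p. cover_projection f (pullback_cover X f \<V>) \<V> p))"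
    using cover_projection_comp[OF cover_projection_pullback r] by simp
  then show "homology_map (nerve \<U>) q r (cech_map X Y q f h \<V>) = cech_map X Y q f h \<U>"
    unfolding cech_map_pullback[OF f h \<V> f \<V>]
      homology_map_projection_comp[OF cover_projection_pullback r
        cech_homology_component[OF h open_cover_pullback[OF f \<V>]]]
    by (rule cech_map_component[OF f h \<U> open_cover_pullback[OF f \<V>], symmetric])
qed

text \<open>Both sides at \<open>\<W>\<close> are computed from the cover obtained by pulling back
  along \<open>g\<close> and then along \<open>f\<close>; the composed projections are a projection
  along \<open>g \<circ> f\<close>.\<close>

lemma cech_map_comp:
  assumes f: "continuous_map X Y f" and g: "continuous_map Y Z g"
    and h: "h \<in> carrier (cech_homology X q)"
  shows "cech_map Y Z q g (cech_map X Y q f h) = cech_map X Z q (g \<circ> f) h"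
proof (rule cech_homology_eqI)
  have gf: "continuous_map X Z (g \<circ> f)" by (rule continuous_map_compose[OF f g])
  show "cech_map X Z q (g \<circ> f) h \<in> carrier (cech_homology Z q)"
    by (rule cech_map_in_carrier[OF gf h])
  have fh: "cech_map X Y q f h \<in> carrier (cech_homology Y q)"
    by (rule cech_map_in_carrier[OF f h])
  then show "cech_map Y Z q g (cech_map X Y q f h) \<in> carrier (cech_homology Z q)"
    by (rule cech_map_in_carrier[OF g])
  fix \<W> assume \<W>: "open_cover Z \<W>"
  note \<V> = open_cover_pullback[OF g \<W>]
  note \<U> = open_cover_pullback[OF f \<V>]
  show "cech_map Y Z q g (cech_map X Y q f h) \<W> = cech_map X Z q (g \<circ> f) h \<W>"
    unfolding cech_map_pullback[OF g fh \<W> g \<W>] cech_map_pullback[OF f h \<V> f \<V>]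
      homology_map_projection_comp[OF cover_projection_pullback cover_projection_pullback
        cech_homology_component[OF h \<U>]]
    by (rule cech_map_component[OF gf h \<W> \<U>, symmetric])
      (rule cover_projection_comp[OF cover_projection_pullback cover_projection_pullback])
qed

text \<open>The pullback covers and the predicates under \<open>SOME\<close> coincide, hence so do
  the chosen projections. This serves maps that equal the identity only on a sublevel set.\<close>

lemma cech_map_cong:
  assumes "\<And>x. x \<in> topspace X \<Longrightarrow> f x = g x"
  shows "cech_map X Y q f = cech_map X Y q g"
proof -
  have pullback: "pullback_cover X f \<U> = pullback_cover X g \<U>" for \<U>
    unfolding pullback_cover_def using assms by (intro image_cong refl) auto
  moreover have "cover_projection f (pullback_cover X g \<U>) \<U> = cover_projection g (pullback_cover X g \<U>) \<U>" for \<U>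
  proof -
    have "f ` V = g ` V" if "V \<in> pullback_cover X g \<U>" for V
      using that assms by (intro image_cong refl) (auto simp: pullback_cover_def)
    then show ?thesis by (auto simp: cover_projection_def fun_eq_iff)
  qed
  ultimately show ?thesis by (simp add: cech_map_def fun_eq_iff)
qed


section \<open>Linear structure\<close>

definition linear_space :: "('k::field, 'm) module \<Rightarrow> bool" where
  "linear_space M \<longleftrightarrow> abelian_monoid M \<and> (\<forall>a. \<forall>x\<in>carrier M. a \<odot>\<^bsub>M\<^esub> x \<in> carrier M)"

text \<open>The range is left open, since images are formed by changing the carrier of the codomain.\<close>

definition linear_map :: "('k::field, 'm) module \<Rightarrow> ('k, 'n) module \<Rightarrow> ('m \<Rightarrow> 'n) \<Rightarrow> bool" where
  "linear_map M N T \<longleftrightarrow> T \<zero>\<^bsub>M\<^esub> = \<zero>\<^bsub>N\<^esub> \<and>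
     (\<forall>x\<in>carrier M. \<forall>y\<in>carrier M. T (x \<oplus>\<^bsub>M\<^esub> y) = T x \<oplus>\<^bsub>N\<^esub> T y) \<and>
     (\<forall>a. \<forall>x\<in>carrier M. T (a \<odot>\<^bsub>M\<^esub> x) = a \<odot>\<^bsub>N\<^esub> T x)"

text \<open>Linearity of \<open>T\<close> gives closure; associativity and commutativity are
  inherited from \<open>N\<close> through \<open>into\<close>.\<close>

lemma linear_space_image:
  assumes M: "linear_space M" and N: "linear_space N" and T: "linear_map M N T"
    and into: "T ` carrier M \<subseteq> carrier N"
  shows "linear_space (N\<lparr>carrier := T ` carrier M\<rparr>)"
proof -
  interpret M: abelian_monoid M using M by (simp add: linear_space_def)
  interpret N: abelian_monoid N using N by (simp add: linear_space_def)
  have "abelian_monoid (N\<lparr>carrier := T ` carrier M\<rparr>)"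
  proof (rule abelian_monoidI)
    show "\<zero>\<^bsub>N\<lparr>carrier := T ` carrier M\<rparr>\<^esub> \<in> carrier (N\<lparr>carrier := T ` carrier M\<rparr>)"
      using T M.zero_closed by (auto simp: linear_map_def intro!: image_eqI[of _ _ "\<zero>\<^bsub>M\<^esub>"])
  next
    fix x y
    assume "x \<in> carrier (N\<lparr>carrier := T ` carrier M\<rparr>)" "y \<in> carrier (N\<lparr>carrier := T ` carrier M\<rparr>)"
    then obtain a b where "a \<in> carrier M" "b \<in> carrier M" "x = T a" "y = T b" by auto
    then show "x \<oplus>\<^bsub>N\<lparr>carrier := T ` carrier M\<rparr>\<^esub> y \<in> carrier (N\<lparr>carrier := T ` carrier M\<rparr>)"
      using T by (auto simp: linear_map_def intro!: image_eqI[of _ _ "a \<oplus>\<^bsub>M\<^esub> b"])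
  qed (use into in \<open>auto simp: N.a_ac image_subset_iff\<close>)
  moreover have "a \<odot>\<^bsub>N\<^esub> T x \<in> T ` carrier M" if "x \<in> carrier M" for a x
    using that M T by (auto simp: linear_space_def linear_map_def intro!: image_eqI[of _ _ "a \<odot>\<^bsub>M\<^esub> x"])
  ultimately show ?thesis by (auto simp: linear_space_def)
qed

text \<open>An independent set in \<open>N\<close> lifts along \<open>T\<close> to one of the same
  size in \<open>M\<close>, because \<open>T\<close> carries a vanishing combination of the lifts to
  one of the original vectors.\<close>

lemma vs_dim_le_of_image:
  assumes M: "linear_space M" and N: "linear_space N" and T: "linear_map M N T"
    and onto: "carrier N \<subseteq> T ` carrier M"
  shows "vs_dim N \<le> vs_dim M"
  unfolding vs_dim_def
proof (rule SUP_least)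
  interpret M: abelian_monoid M using M by (simp add: linear_space_def)
  interpret N: abelian_monoid N using N by (simp add: linear_space_def)
  fix S assume "S \<in> {S. lin_independent N S}"
  then have fin: "finite S" and sub: "S \<subseteq> carrier N"
    and ind: "\<And>c. (\<Oplus>\<^bsub>N\<^esub>x\<in>S. c x \<odot>\<^bsub>N\<^esub> x) = \<zero>\<^bsub>N\<^esub> \<Longrightarrow> \<forall>x\<in>S. c x = 0"
    unfolding lin_independent_def mem_Collect_eq by blast+
  define g where "g = inv_into (carrier M) T"
  have g: "g s \<in> carrier M" "T (g s) = s" if "s \<in> S" for s
    using subsetD[OF onto subsetD[OF sub that]] unfolding g_def
    by (rule inv_into_into, rule f_inv_into_f)
  \<comment> \<open>The left inverse \<open>T\<close> makes \<open>g\<close> injective, so lifting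
    preserves cardinality.\<close>
  have inj: "inj_on g S" by (rule inj_on_inverseI[of S T]) (rule g(2))
  have smultM: "a \<odot>\<^bsub>M\<^esub> x \<in> carrier M" if "x \<in> carrier M" for a x
    using M that by (simp add: linear_space_def)
  have smultN: "a \<odot>\<^bsub>N\<^esub> x \<in> carrier N" if "x \<in> carrier N" for a x
    using N that by (simp add: linear_space_def)
  have T_sum: "T (\<Oplus>\<^bsub>M\<^esub>x\<in>g ` F. c x \<odot>\<^bsub>M\<^esub> x) = (\<Oplus>\<^bsub>N\<^esub>x\<in>F. c (g x) \<odot>\<^bsub>N\<^esub> x)"
    if "F \<subseteq> S" for c F
    using finite_subset[OF that fin] that
  proof (induction F rule: finite_induct)
    case empty
    then show ?case using T by (simp add: linear_map_def)
  next
    case (insert s F)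
    then have s: "s \<in> S" "F \<subseteq> S" by auto
    have "g s \<notin> g ` F" using inj insert.hyps(2) s by (auto dest: inj_onD)
    then have "(\<Oplus>\<^bsub>M\<^esub>x\<in>g ` insert s F. c x \<odot>\<^bsub>M\<^esub> x)
        = c (g s) \<odot>\<^bsub>M\<^esub> g s \<oplus>\<^bsub>M\<^esub> (\<Oplus>\<^bsub>M\<^esub>x\<in>g ` F. c x \<odot>\<^bsub>M\<^esub> x)"
      using insert.hyps s g(1) by (auto intro!: M.finsum_insert smultM)
    moreover have "(\<Oplus>\<^bsub>M\<^esub>x\<in>g ` F. c x \<odot>\<^bsub>M\<^esub> x) \<in> carrier M"
      using s g(1) by (auto intro!: M.finsum_closed smultM)
    moreover have "(\<Oplus>\<^bsub>N\<^esub>x\<in>insert s F. c (g x) \<odot>\<^bsub>N\<^esub> x)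
        = c (g s) \<odot>\<^bsub>N\<^esub> s \<oplus>\<^bsub>N\<^esub> (\<Oplus>\<^bsub>N\<^esub>x\<in>F. c (g x) \<odot>\<^bsub>N\<^esub> x)"
      using insert.hyps s sub by (auto intro!: N.finsum_insert smultN)
    ultimately show ?case
      using insert.IH s g T smultM by (simp add: linear_map_def)
  qed
  have "lin_independent M (g ` S)"
    unfolding lin_independent_def
  proof (intro conjI allI impI)
    fix c assume "(\<Oplus>\<^bsub>M\<^esub>x\<in>g ` S. c x \<odot>\<^bsub>M\<^esub> x) = \<zero>\<^bsub>M\<^esub>"
    then have "(\<Oplus>\<^bsub>N\<^esub>x\<in>S. c (g x) \<odot>\<^bsub>N\<^esub> x) = \<zero>\<^bsub>N\<^esub>"
      using T_sum[of S c] T by (simp add: linear_map_def)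
    then have "\<forall>x\<in>S. c (g x) = 0" by (rule ind)
    then show "\<forall>x\<in>g ` S. c x = 0" by simp
  qed (use fin g(1) in auto)
  then show "enat (card S) \<le> (SUP S\<in>{S. lin_independent M S}. enat (card S))"
    using inj by (intro SUP_upper2[of "g ` S"]) (auto simp: card_image)
qed

text \<open>The operations are componentwise. Refinement maps are linear, so compatible families are
  closed under them, and the laws hold because they hold in each component.\<close>

lemma linear_space_cech_homology:
  "linear_space (cech_homology X q :: ('k::field, 'a set set \<Rightarrow> ('a set, 'k) chain set) module)"
    (is "linear_space ?H")
proof -
  let ?C = "\<lambda>\<U>. simplicial_homology (nerve \<U>) q :: ('k, ('a set, 'k) chain set) module"
  interpret C: abelian_monoid "?C \<U>" for \<U>
    by (rule abelian_monoid_simplicial_homology)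
  have add: "h \<oplus>\<^bsub>?H\<^esub> h' = (\<lambda>\<U>\<in>{\<U>. open_cover X \<U>}. h \<U> \<oplus>\<^bsub>?C \<U>\<^esub> h' \<U>)" for h h'
    by (simp add: cech_homology_def)
  have zero: "\<zero>\<^bsub>?H\<^esub> = (\<lambda>\<U>\<in>{\<U>. open_cover X \<U>}. \<zero>\<^bsub>?C \<U>\<^esub>)"
    by (simp add: cech_homology_def)
  have smult: "a \<odot>\<^bsub>?H\<^esub> h = (\<lambda>\<U>\<in>{\<U>. open_cover X \<U>}. a \<odot>\<^bsub>?C \<U>\<^esub> h \<U>)" for a h
    by (simp add: cech_homology_def)
  note [simp] = cech_homology_component cech_homology_compatible
  note map_simps = homology_map_add[OF cover_projection_simplicial_map]
    homology_map_zero[OF cover_projection_simplicial_map]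
    homology_map_smult[OF cover_projection_simplicial_map]
  have add_closed: "h \<oplus>\<^bsub>?H\<^esub> h' \<in> carrier ?H" if "h \<in> carrier ?H" "h' \<in> carrier ?H" for h h'
    unfolding add by (rule in_carrier_cech_homologyI) (use that in \<open>auto simp: map_simps\<close>)
  have zero_closed: "\<zero>\<^bsub>?H\<^esub> \<in> carrier ?H"
    unfolding zero by (rule in_carrier_cech_homologyI) (auto simp: map_simps)
  have smult_closed: "a \<odot>\<^bsub>?H\<^esub> h \<in> carrier ?H" if "h \<in> carrier ?H" for a h
    unfolding smult by (rule in_carrier_cech_homologyI)
      (use that in \<open>auto simp: map_simps simplicial_homology_smult_closed\<close>)
  have "abelian_monoid ?H"
  proof (rule abelian_monoidI)
    fix x y z assume "x \<in> carrier ?H" "y \<in> carrier ?H" "z \<in> carrier ?H"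
    then show "(x \<oplus>\<^bsub>?H\<^esub> y) \<oplus>\<^bsub>?H\<^esub> z = x \<oplus>\<^bsub>?H\<^esub> (y \<oplus>\<^bsub>?H\<^esub> z)"
      by (intro cech_homology_eqI[of _ X q] add_closed) (auto simp: add C.a_assoc)
  next
    fix x assume "x \<in> carrier ?H"
    then show "\<zero>\<^bsub>?H\<^esub> \<oplus>\<^bsub>?H\<^esub> x = x"
      by (intro cech_homology_eqI[of _ X q] add_closed zero_closed) (auto simp: add zero)
  next
    fix x y assume "x \<in> carrier ?H" "y \<in> carrier ?H"
    then show "x \<oplus>\<^bsub>?H\<^esub> y = y \<oplus>\<^bsub>?H\<^esub> x"
      by (intro cech_homology_eqI[of _ X q] add_closed) (auto simp: add C.a_comm)
  qed (auto simp: add_closed zero_closed)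
  then show ?thesis using smult_closed by (simp add: linear_space_def)
qed

text \<open>Each component is an induced map on the homology of nerves, which is linear.\<close>

lemma linear_map_cech_map:
  assumes f: "continuous_map X Y f"
  shows "linear_map (cech_homology X q :: ('k::field, 'a set set \<Rightarrow> ('a set, 'k) chain set) module)
    (cech_homology Y q) (cech_map X Y q f)"
proof -
  note [simp] = cech_homology_component open_cover_pullback[OF f]
    homology_map_add[OF cover_projection_simplicial_map[OF cover_projection_pullback]]
    homology_map_zero[OF cover_projection_simplicial_map[OF cover_projection_pullback]]
    homology_map_smult[OF cover_projection_simplicial_map[OF cover_projection_pullback]]
  show ?thesis
    unfolding linear_map_def
  proof (intro conjI ballI allI)
    show "cech_map X Y q f \<zero>\<^bsub>cech_homology X q\<^esub> = \<zero>\<^bsub>cech_homology Y q\<^esub>"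
      by (simp add: cech_map_def fun_eq_iff) (simp add: cech_homology_def)
  next
    fix x y assume "x \<in> carrier (cech_homology X q :: ('k, _) module)"
      "y \<in> carrier (cech_homology X q :: ('k, _) module)"
    then show "cech_map X Y q f (x \<oplus>\<^bsub>cech_homology X q\<^esub> y)
        = cech_map X Y q f x \<oplus>\<^bsub>cech_homology Y q\<^esub> cech_map X Y q f y"
      by (auto simp: cech_map_def fun_eq_iff cech_homology_def[of X q] cech_homology_def[of Y q] PiE_iff)
  next
    fix a :: 'k and x assume "x \<in> carrier (cech_homology X q :: ('k, _) module)"
    then show "cech_map X Y q f (a \<odot>\<^bsub>cech_homology X q\<^esub> x) = a \<odot>\<^bsub>cech_homology Y q\<^esub> cech_map X Y q f x"
      by (auto simp: cech_map_def fun_eq_iff cech_homology_def[of X q] cech_homology_def[of Y q] PiE_iff)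
  qed
qed

section \<open>Persistent Betti numbers\<close>

lemma topspace_sublevel: "topspace (sublevel X f u) = {x \<in> topspace X. \<forall>j. f x $ j \<le> u $ j}"
  by (auto simp: sublevel_def)

text \<open>Covers the inclusions (\<open>h = id\<close>) as well as the homeomorphism and its
  inverse between sublevel sets.\<close>

lemma continuous_map_sublevel:
  assumes "continuous_map X Y h"
    and "\<And>x. x \<in> topspace X \<Longrightarrow> \<forall>j. f x $ j \<le> u $ j \<Longrightarrow> \<forall>j. g (h x) $ j \<le> w $ j"
  shows "continuous_map (sublevel X f u) (sublevel Y g w) h"
proof -
  have "h x \<in> topspace Y" if "x \<in> topspace X" for x
    using assms(1) that by (auto simp: continuous_map_def)
  then show ?thesis
    unfolding sublevel_def using assms
    by (auto simp: continuous_map_in_subtopology continuous_map_from_subtopology)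
qed

text \<open>By functoriality the inclusion-induced map for \<open>X\<close> is the one for
  \<open>Y\<close> preceded by \<open>\<phi>\<close> and followed by \<open>\<psi>\<close>. Hence
  \<open>\<psi>\<close> maps the image for \<open>Y\<close> onto a set containing the image for
  \<open>X\<close>, which bounds the rank.\<close>

lemma persistent_betti_le_of_factorization:
  fixes X :: "'a topology" and Y :: "'b topology"
    and f :: "'a \<Rightarrow> real^'n" and g :: "'b \<Rightarrow> real^'n"
  assumes uv: "\<And>j. u $ j \<le> v $ j" and uv': "\<And>j. u' $ j \<le> v' $ j"
    and \<phi>: "continuous_map (sublevel X f u) (sublevel Y g u') \<phi>"
    and \<psi>: "continuous_map (sublevel Y g v') (sublevel X f v) \<psi>"
    and inverse: "\<And>x. x \<in> topspace (sublevel X f u) \<Longrightarrow> \<psi> (\<phi> x) = x"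
  shows "persistent_betti TYPE('k::field) X f i u v \<le> persistent_betti TYPE('k) Y g i u' v'"
proof -
  let ?Xu = "cech_homology (sublevel X f u) i :: ('k, 'a set set \<Rightarrow> ('a set, 'k) chain set) module"
  let ?Xv = "cech_homology (sublevel X f v) i :: ('k, 'a set set \<Rightarrow> ('a set, 'k) chain set) module"
  let ?Yu = "cech_homology (sublevel Y g u') i :: ('k, 'b set set \<Rightarrow> ('b set, 'k) chain set) module"
  let ?Yv = "cech_homology (sublevel Y g v') i :: ('k, 'b set set \<Rightarrow> ('b set, 'k) chain set) module"
  let ?jX = "cech_map (sublevel X f u) (sublevel X f v) i id
    :: ('a set set \<Rightarrow> ('a set, 'k) chain set) \<Rightarrow> 'a set set \<Rightarrow> ('a set, 'k) chain set"
  let ?jY = "cech_map (sublevel Y g u') (sublevel Y g v') i id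
    :: ('b set set \<Rightarrow> ('b set, 'k) chain set) \<Rightarrow> 'b set set \<Rightarrow> ('b set, 'k) chain set"
  let ?\<phi> = "cech_map (sublevel X f u) (sublevel Y g u') i \<phi>
    :: ('a set set \<Rightarrow> ('a set, 'k) chain set) \<Rightarrow> 'b set set \<Rightarrow> ('b set, 'k) chain set"
  let ?\<psi> = "cech_map (sublevel Y g v') (sublevel X f v) i \<psi>
    :: ('b set set \<Rightarrow> ('b set, 'k) chain set) \<Rightarrow> 'a set set \<Rightarrow> ('a set, 'k) chain set"
  have idX: "continuous_map (sublevel X f u) (sublevel X f v) id"
    by (rule continuous_map_sublevel) (use uv order_trans in \<open>auto, blast\<close>)
  have idY: "continuous_map (sublevel Y g u') (sublevel Y g v') id"
    by (rule continuous_map_sublevel) (use uv' order_trans in \<open>auto, blast\<close>)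
  have factor: "?jX a = ?\<psi> (?jY (?\<phi> a))" if a: "a \<in> carrier ?Xu" for a
  proof -
    have "?\<psi> (?jY (?\<phi> a)) = cech_map (sublevel X f u) (sublevel X f v) i (\<psi> \<circ> (id \<circ> \<phi>)) a"
      unfolding cech_map_comp[OF \<phi> idY a]
      by (rule cech_map_comp[OF continuous_map_compose[OF \<phi> idY] \<psi> a])
    also have "\<dots> = ?jX a"
      \<comment> \<open>\<open>\<psi> \<circ> \<phi>\<close> is the identity on the sublevel set of
        \<open>u\<close>, which is all that the induced map sees.\<close>
      by (rule fun_cong[OF cech_map_cong]) (simp add: inverse)
    finally show ?thesis by simp
  qed
  have jX: "?jX ` carrier ?Xu \<subseteq> carrier ?Xv"
    using cech_map_in_carrier[OF idX] by blast
  have jY: "?jY ` carrier ?Yu \<subseteq> carrier ?Yv"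
    using cech_map_in_carrier[OF idY] by blast
  have "vs_dim (?Xv\<lparr>carrier := ?jX ` carrier ?Xu\<rparr>) \<le> vs_dim (?Yv\<lparr>carrier := ?jY ` carrier ?Yu\<rparr>)"
  proof (rule vs_dim_le_of_image)
    show "linear_space (?Xv\<lparr>carrier := ?jX ` carrier ?Xu\<rparr>)"
      by (rule linear_space_image[OF linear_space_cech_homology linear_space_cech_homology
            linear_map_cech_map[OF idX] jX])
    show "linear_space (?Yv\<lparr>carrier := ?jY ` carrier ?Yu\<rparr>)"
      by (rule linear_space_image[OF linear_space_cech_homology linear_space_cech_homology
            linear_map_cech_map[OF idY] jY])
    show "linear_map (?Yv\<lparr>carrier := ?jY ` carrier ?Yu\<rparr>) (?Xv\<lparr>carrier := ?jX ` carrier ?Xu\<rparr>) ?\<psi>"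
      using linear_map_cech_map[OF \<psi>, of i, where ?'k = 'k] subsetD[OF jY]
      by (simp add: linear_map_def)
    show "carrier (?Xv\<lparr>carrier := ?jX ` carrier ?Xu\<rparr>)
        \<subseteq> ?\<psi> ` carrier (?Yv\<lparr>carrier := ?jY ` carrier ?Yu\<rparr>)"
      \<comment> \<open>The preimage of \<open>?jX a\<close> is
        \<open>?jY (?\<phi> a)\<close>.\<close>
      using factor cech_map_in_carrier[OF \<phi>, where ?'c = 'k] by auto
  qed
  then show ?thesis by (simp add: persistent_betti_def)
qed

section \<open>The lower bound for the natural pseudodistance\<close>

theorem mainTheorem4:
  fixes X :: "'a topology" and Y :: "'b topology"
    and f :: "'a \<Rightarrow> real^'n" and g :: "'b \<Rightarrow> real^'n"
    and u v u' v' :: "real^'n" and i :: int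
  assumes "triangulable TYPE('m1::euclidean_space) X"
    and "triangulable TYPE('m2::euclidean_space) Y"
    and "continuous_map X euclidean f" and "continuous_map Y euclidean g"
    and "(u, v) \<in> Delta_plus" and "(u', v') \<in> Delta_plus"
    and "persistent_betti TYPE('k::field) X f i u v > persistent_betti TYPE('k) Y g i u' v'"
  shows "enn2ereal (natural_pseudodistance X f Y g)
           \<ge> ereal (min (MIN r. u' $ r - u $ r) (MIN r. v $ r - v' $ r))"
proof (rule ccontr)
  define e where "e = min (MIN r. u' $ r - u $ r) (MIN r. v $ r - v' $ r)"
  have eu: "e \<le> u' $ r - u $ r" for r
    unfolding e_def by (rule min.coboundedI1) (simp add: Min_le)
  have ev: "e \<le> v $ r - v' $ r" for r
    unfolding e_def by (rule min.coboundedI2) (simp add: Min_le)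
  assume "\<not> ?thesis"
  then have less: "enn2ereal (natural_pseudodistance X f Y g) < ereal e"
    unfolding e_def by (simp only: not_le)
  \<comment> \<open>Positivity of \<open>e\<close> allows the comparison to move to
    \<open>ennreal\<close>, where negative reals would collapse to 0.\<close>
  have "0 < ereal e" by (rule le_less_trans[OF enn2ereal_nonneg less])
  then have e: "0 < e" by simp
  have "natural_pseudodistance X f Y g < ennreal e"
    using less e by (simp add: less_ennreal.rep_eq enn2ereal_ennreal)
  \<comment> \<open>A value below \<open>ennreal e\<close> is finite, which rules out the branch for
    spaces that are not homeomorphic.\<close>
  then have "(INF h\<in>{h. homeomorphic_map X Y h}. SUP x\<in>topspace X. ennreal (infnorm (f x - g (h x)))) < ennreal e"
    by (auto simp: natural_pseudodistance_def split: if_splits)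
  \<comment> \<open>Strictness of the inequality yields a single homeomorphism, whether or not the
    infimum is attained.\<close>
  then obtain h where h: "homeomorphic_map X Y h"
    and sup: "(SUP x\<in>topspace X. ennreal (infnorm (f x - g (h x)))) < ennreal e"
    by (auto simp: INF_less_iff)
  have close: "\<bar>f x $ j - g (h x) $ j\<bar> < e" if "x \<in> topspace X" for x j
  proof -
    have "ennreal (infnorm (f x - g (h x))) < ennreal e"
      by (rule le_less_trans[OF SUP_upper[OF that] sup])
    then have "infnorm (f x - g (h x)) < e"
      using e by (simp add: ennreal_less_iff infnorm_pos_le)
    then show ?thesis
      using component_le_infnorm_cart[of "f x - g (h x)" j] by simp
  qed
  obtain k where k: "homeomorphic_maps X Y h k"
    using h by (auto simp: homeomorphic_map_maps)
  have "persistent_betti TYPE('k) X f i u v \<le> persistent_betti TYPE('k) Y g i u' v'"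
  proof (rule persistent_betti_le_of_factorization)
    show "u $ j \<le> v $ j" "u' $ j \<le> v' $ j" for j
      using assms(5,6) by (auto simp: Delta_plus_def less_imp_le)
    show "continuous_map (sublevel X f u) (sublevel Y g u') h"
    proof (rule continuous_map_sublevel)
      show "continuous_map X Y h" using k by (simp add: homeomorphic_maps_def)
      fix x assume x: "x \<in> topspace X" and le: "\<forall>j. f x $ j \<le> u $ j"
      show "\<forall>j. g (h x) $ j \<le> u' $ j"
      proof
        \<comment> \<open>The bound is \<open>f x $ j + e\<close>, at most
          \<open>u $ j + (u' $ j - u $ j)\<close>.\<close>
        fix j show "g (h x) $ j \<le> u' $ j"
          using close[OF x, of j] spec[OF le, of j] eu[of j] by linarith
      qed
    qed
    show "continuous_map (sublevel Y g v') (sublevel X f v) k"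
    proof (rule continuous_map_sublevel)
      show k': "continuous_map Y X k" using k by (simp add: homeomorphic_maps_def)
      fix y assume y: "y \<in> topspace Y" and le: "\<forall>j. g y $ j \<le> v' $ j"
      have "k y \<in> topspace X" "h (k y) = y"
        using k k' y by (auto simp: homeomorphic_maps_def continuous_map_def)
      \<comment> \<open>The estimate at the point \<open>k y\<close> becomes one about
        \<open>g y\<close>, because \<open>h (k y) = y\<close>.\<close>
      then have close': "\<bar>f (k y) $ j - g y $ j\<bar> < e" for j
        using close[of "k y" j] by simp
      show "\<forall>j. f (k y) $ j \<le> v $ j"
      proof
        \<comment> \<open>The bound is \<open>g y $ j + e\<close>, at most
          \<open>v' $ j + (v $ j - v' $ j)\<close>.\<close>
        fix j show "f (k y) $ j \<le> v $ j"
          using close'[of j] spec[OF le, of j] ev[of j] by linarith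
      qed
    qed
    show "k (h x) = x" if "x \<in> topspace (sublevel X f u)" for x
      using that k by (simp add: homeomorphic_maps_def topspace_sublevel)
  qed
  then show False using assms(7) by simp
qed

end
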